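(* Let $P$ be a finite poset on a set $S_P$ of $n$ elements, let $h: S_P \to \{1,2,\ldots,n\}$ be a bijection, and let $C_P \subseteq S_P \times S_P$ be a set of pairs of distinct elements satisfying: (1) if $x<y$ in $P$ and $h(x)<h(y)$, then $(x,y)\in C_P$; (2) if $(x,y)\in C_P$ then $h(x)<h(y)$; (3) if $(x,y)\in C_P$ and $(y,z)\in C_P$ then $(x,z)\in C_P$. Let $A'_k$ and $D'_k$ be as defined in the context. Set $\lambda_1 = A'_1$, $\mu_1 = D'_1$, and for $k\ge 2$ set $\lambda_k = A'_k - A'_{k-1}$, $\mu_k = D'_k - D'_{k-1}$. Then $n = \lambda_1+\lambda_2+\cdots$ and $n = \mu_1+\mu_2+\cdots$ are partitions of $n$ (i.e. the $\lambda_k$ and the $\mu_k$ are nonnegative integers, weakly decreasing in $k$, summing to $n$), and these two partitions are conjugate to each other.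
   Context: A sequence $s_1,\ldots,s_m$ of distinct elements of $S_P$ is called adjacentable if $(s_j,s_{j+1})\in C_P$ for every $1\le j\le m-1$, and $h$-ordered if $h(s_j)<h(s_{j+1})$ for every $j$. For an adjacentable sequence $S=(s_1,\ldots,s_m)$, $asc(S)$ is the number of indices $j$ with $s_j<s_{j+1}$ in $P$, plus one; $asc(S)=0$ if $S$ is empty. For an $h$-ordered sequence $S$, $desc(S)$ is the maximum length of a subsequence $s'_1,\ldots,s'_r$ of $S$ such that $s'_i \not< s'_j$ in $P$ for all $i<j$ (and $desc$ of the empty sequence is $0$). Two disjoint $h$-ordered sequences $(s_1,\ldots,s_m)$ and $(t_1,\ldots,t_l)$ are called semi-overlapping if there exist indices $i,j,k,l'$ with $(t_j,s_i)\in C_P$ and $(s_k,t_{l'})\in C_P$. $A'_k$ is the maximum, over all sets $\{S_1,\ldots,S_k\}$ of $k$ pairwise disjoint adjacentable sequences (sequences may be empty), of $asc(S_1)+\cdots+asc(S_k)$. $D'_k$ is the maximum, over all sets $\{S_1,\ldots,S_k\}$ of $k$ pairwise disjoint $h$-ordered sequences no two of which are semi-overlapping, of $desc(S_1)+\cdots+desc(S_k)$. *)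

theory Defs
  imports Main "HOL-Library.Sublist"
begin

text \<open>
  A finite poset on \<open>S\<close> is given by its reflexive order relation \<open>r\<close> with
  \<^term>\<open>partial_order_on S r\<close>; \<open>x < y\<close> in the poset is \<open>(x, y) \<in> r - Id\<close>.
  Sequences are lists.
\<close>

definition adjacentable :: "'a set \<Rightarrow> 'a rel \<Rightarrow> 'a list \<Rightarrow> bool" where
  "adjacentable S C xs \<longleftrightarrow>
     set xs \<subseteq> S \<and> distinct xs \<and> successively (\<lambda>x y. (x, y) \<in> C) xs"

definition h_ordered :: "'a set \<Rightarrow> ('a \<Rightarrow> nat) \<Rightarrow> 'a list \<Rightarrow> bool" where
  "h_ordered S h xs \<longleftrightarrow>
     set xs \<subseteq> S \<and> distinct xs \<and> successively (\<lambda>x y. h x < h y) xs"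

definition asc :: "'a rel \<Rightarrow> 'a list \<Rightarrow> nat" where
  "asc r xs =
     (if xs = [] then 0
      else card {j. Suc j < length xs \<and> (xs ! j, xs ! Suc j) \<in> r - Id} + 1)"

definition desc :: "'a rel \<Rightarrow> 'a list \<Rightarrow> nat" where
  "desc r xs =
     Max {length ys |ys. subseq ys xs \<and> sorted_wrt (\<lambda>x y. (x, y) \<notin> r - Id) ys}"

definition semi_overlapping :: "'a rel \<Rightarrow> 'a list \<Rightarrow> 'a list \<Rightarrow> bool" where
  "semi_overlapping C ss ts \<longleftrightarrow>
     (\<exists>t\<in>set ts. \<exists>s\<in>set ss. (t, s) \<in> C) \<and> (\<exists>s\<in>set ss. \<exists>t\<in>set ts. (s, t) \<in> C)"

text \<open>
  A family of \<open>k\<close> sequences is a list of length \<open>k\<close>, so that the empty sequence may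
  occur several times.
\<close>

definition pairwise_disjoint :: "'a list list \<Rightarrow> bool" where
  "pairwise_disjoint Ss \<longleftrightarrow>
     (\<forall>i<length Ss. \<forall>j<length Ss. i \<noteq> j \<longrightarrow> set (Ss ! i) \<inter> set (Ss ! j) = {})"

definition A_families :: "'a set \<Rightarrow> 'a rel \<Rightarrow> nat \<Rightarrow> 'a list list set" where
  "A_families S C k =
     {Ss. length Ss = k \<and> (\<forall>xs\<in>set Ss. adjacentable S C xs) \<and> pairwise_disjoint Ss}"

definition D_families :: "'a set \<Rightarrow> ('a \<Rightarrow> nat) \<Rightarrow> 'a rel \<Rightarrow> nat \<Rightarrow> 'a list list set" where
  "D_families S h C k =
     {Ss. length Ss = k \<and> (\<forall>xs\<in>set Ss. h_ordered S h xs) \<and> pairwise_disjoint Ss \<and>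
          (\<forall>i<k. \<forall>j<k. i \<noteq> j \<longrightarrow> \<not> semi_overlapping C (Ss ! i) (Ss ! j))}"

definition A' :: "'a set \<Rightarrow> 'a rel \<Rightarrow> 'a rel \<Rightarrow> nat \<Rightarrow> nat" where
  "A' S r C k = Max ((\<lambda>Ss. \<Sum>xs\<leftarrow>Ss. asc r xs) ` A_families S C k)"

definition D' :: "'a set \<Rightarrow> 'a rel \<Rightarrow> ('a \<Rightarrow> nat) \<Rightarrow> 'a rel \<Rightarrow> nat \<Rightarrow> nat" where
  "D' S r h C k = Max ((\<lambda>Ss. \<Sum>xs\<leftarrow>Ss. desc r xs) ` D_families S h C k)"

text \<open>
  Partitions are integer sequences indexed from 1 with finitely many nonzero terms; the
  value at index 0 is irrelevant.
\<close>

definition is_partition :: "nat \<Rightarrow> (nat \<Rightarrow> int) \<Rightarrow> bool" where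
  "is_partition n a \<longleftrightarrow>
     (\<forall>k\<ge>1. 0 \<le> a k) \<and> (\<forall>k\<ge>1. a (Suc k) \<le> a k) \<and>
     finite {k. 1 \<le> k \<and> a k \<noteq> 0} \<and> (\<Sum>k | 1 \<le> k \<and> a k \<noteq> 0. a k) = int n"

definition conjugate_of :: "(nat \<Rightarrow> int) \<Rightarrow> (nat \<Rightarrow> int) \<Rightarrow> bool" where
  "conjugate_of b a \<longleftrightarrow> (\<forall>j\<ge>1. b j = int (card {i. 1 \<le> i \<and> int j \<le> a i}))"

text \<open>The sets whose maximum is taken above are finite and nonempty.\<close>

lemma desc_set_wf:
  "finite {length ys |ys. subseq ys xs \<and> sorted_wrt (\<lambda>x y. (x, y) \<notin> r - Id) ys}"
  "{length ys |ys. subseq ys xs \<and> sorted_wrt (\<lambda>x y. (x, y) \<notin> r - Id) ys} \<noteq> {}"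
proof -
  have "{length ys |ys. subseq ys xs \<and> sorted_wrt (\<lambda>x y. (x, y) \<notin> r - Id) ys} \<subseteq> {..length xs}"
    by (auto dest: list_emb_length)
  then show "finite {length ys |ys. subseq ys xs \<and> sorted_wrt (\<lambda>x y. (x, y) \<notin> r - Id) ys}"
    by (rule finite_subset) simp
  show "{length ys |ys. subseq ys xs \<and> sorted_wrt (\<lambda>x y. (x, y) \<notin> r - Id) ys} \<noteq> {}"
    by (auto intro!: exI[of _ "[]"])
qed

lemma finite_families:
  assumes "finite S"
  shows "finite {Ss. length Ss = k \<and> (\<forall>xs\<in>set Ss. set xs \<subseteq> S \<and> distinct xs)}"
proof -
  have "finite {xs. set xs \<subseteq> S \<and> distinct xs}"
    using assms by (rule finite_subset_distinct)
  then have "finite {Ss. set Ss \<subseteq> {xs. set xs \<subseteq> S \<and> distinct xs} \<and> length Ss = k}"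
    by (rule finite_lists_length_eq)
  then show ?thesis
    by (rule rev_finite_subset) auto
qed

lemma A_families_wf:
  assumes "finite S"
  shows "finite (A_families S C k)" "A_families S C k \<noteq> {}"
proof -
  show "finite (A_families S C k)"
    by (rule finite_subset[OF _ finite_families[OF assms, of k]])
       (auto simp: A_families_def adjacentable_def)
  have "replicate k [] \<in> A_families S C k"
    by (auto simp: A_families_def adjacentable_def pairwise_disjoint_def)
  then show "A_families S C k \<noteq> {}" by blast
qed

lemma D_families_wf:
  assumes "finite S"
  shows "finite (D_families S h C k)" "D_families S h C k \<noteq> {}"
proof -
  show "finite (D_families S h C k)"
    by (rule finite_subset[OF _ finite_families[OF assms, of k]])
       (auto simp: D_families_def h_ordered_def)
  have "replicate k [] \<in> D_families S h C k"
    by (auto simp: D_families_def h_ordered_def pairwise_disjoint_def semi_overlapping_def)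
  then show "D_families S h C k \<noteq> {}" by blast
qed

end

theory Submission
  imports Defs
begin

text \<open>
  Fix \<open>l\<close> pairwise non-semi-overlapping antichains with union \<open>X\<close>. Deleting an element from a
  \<open>C\<close>-chain costs at most one ascent, and once the elements outside \<open>X\<close> are deleted, the ascents
  occur only where the chain passes from one antichain to another, which it does at most \<open>l - 1\<close>
  times. Counting gives the weak duality \<open>A'\<^sub>k + D'\<^sub>l \<le> n + k l\<close>.

  A family of \<open>k\<close> disjoint \<open>C\<close>-chains is the same as a matching with \<open>n - k\<close> edges between two
  copies of \<open>S\<close>, where a loop marks an unused element. The potentials in an optimal dual of the
  corresponding weighted matching problem have antichain families as level sets, so that for each
  \<open>k\<close> some \<open>l\<close>, and for each \<open>l\<close> some \<open>k\<close>, attains equality in the weak duality. This forces both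
  sequences to be concave and their increments to be conjugate.
\<close>

section \<open>Duality for bipartite matchings\<close>

definition hall_condition :: "'a set \<Rightarrow> ('a \<times> 'b) set \<Rightarrow> bool" where
  "hall_condition L E \<longleftrightarrow> (\<forall>X\<subseteq>L. card X \<le> card (E `` X))"

text \<open>
  Rado's proof of Hall's theorem: violators \<open>X\<^sub>1\<close> and \<open>X\<^sub>2\<close> for both deletions would contradict
  the submodularity of \<open>card (E `` X)\<close> in \<open>X\<close>.
\<close>

lemma hall_condition_remove_edge:
  assumes "finite L" and "finite E" and hall: "hall_condition L E"
    and edges: "(x, y\<^sub>1) \<in> E" "(x, y\<^sub>2) \<in> E" "y\<^sub>1 \<noteq> y\<^sub>2"
  shows "hall_condition L (E - {(x, y\<^sub>1)}) \<or> hall_condition L (E - {(x, y\<^sub>2)})"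
proof (rule ccontr)
  assume "\<not> ?thesis"
  then obtain X\<^sub>1 X\<^sub>2 where X: "X\<^sub>1 \<subseteq> L" "X\<^sub>2 \<subseteq> L"
      and less: "card ((E - {(x, y\<^sub>1)}) `` X\<^sub>1) < card X\<^sub>1"
        "card ((E - {(x, y\<^sub>2)}) `` X\<^sub>2) < card X\<^sub>2"
    by (auto simp: hall_condition_def not_le)
  let ?N\<^sub>1 = "(E - {(x, y\<^sub>1)}) `` X\<^sub>1" and ?N\<^sub>2 = "(E - {(x, y\<^sub>2)}) `` X\<^sub>2"
  have fin: "finite X\<^sub>1" "finite X\<^sub>2" "finite ?N\<^sub>1" "finite ?N\<^sub>2"
    using X[THEN finite_subset] assms(1,2) by simp_all
  have "x \<in> X" if "X \<subseteq> L" "card ((E - {(x, y)}) `` X) < card X" for X y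
  proof (rule ccontr)
    assume "x \<notin> X"
    then have "(E - {(x, y)}) `` X = E `` X" by auto
    then show False using hall that by (auto simp: hall_condition_def not_le)
  qed
  then have x: "x \<in> X\<^sub>1 \<inter> X\<^sub>2" using X less by blast
  have "card (X\<^sub>1 \<union> X\<^sub>2) + card (X\<^sub>1 \<inter> X\<^sub>2 - {x})
      \<le> card (E `` (X\<^sub>1 \<union> X\<^sub>2)) + card (E `` (X\<^sub>1 \<inter> X\<^sub>2 - {x}))"
    using X by (intro add_mono hall[unfolded hall_condition_def, rule_format]) auto
  also have "\<dots> \<le> card (?N\<^sub>1 \<union> ?N\<^sub>2) + card (?N\<^sub>1 \<inter> ?N\<^sub>2)"
    using fin x edges by (intro add_mono card_mono) auto
  also have "\<dots> = card ?N\<^sub>1 + card ?N\<^sub>2"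
    using card_Un_Int[OF fin(3,4)] by simp
  finally have "card (X\<^sub>1 \<union> X\<^sub>2) + card (X\<^sub>1 \<inter> X\<^sub>2 - {x}) \<le> card ?N\<^sub>1 + card ?N\<^sub>2" .
  moreover have "card (X\<^sub>1 \<inter> X\<^sub>2) = Suc (card (X\<^sub>1 \<inter> X\<^sub>2 - {x}))"
    using fin x by (intro card.remove) auto
  ultimately show False using less card_Un_Int[OF fin(1,2)] by linarith
qed

theorem hall_marriage:
  assumes "finite E" and "finite L" and "hall_condition L E"
  shows "\<exists>f. inj_on f L \<and> (\<forall>x\<in>L. (x, f x) \<in> E)"
  using assms
proof (induction E rule: finite_psubset_induct)
  case (psubset E)
  show ?case
  proof (cases "\<exists>x y\<^sub>1 y\<^sub>2. (x, y\<^sub>1) \<in> E \<and> (x, y\<^sub>2) \<in> E \<and> y\<^sub>1 \<noteq> y\<^sub>2")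
    case True
    then obtain x y\<^sub>1 y\<^sub>2 where edges: "(x, y\<^sub>1) \<in> E" "(x, y\<^sub>2) \<in> E" "y\<^sub>1 \<noteq> y\<^sub>2"
      by blast
    then obtain e where e: "e \<in> E" "hall_condition L (E - {e})"
      using hall_condition_remove_edge[OF psubset.prems(1) psubset.hyps psubset.prems(2) edges]
      by metis
    then obtain f where "inj_on f L" "\<forall>x\<in>L. (x, f x) \<in> E - {e}"
      using psubset.IH[of "E - {e}"] psubset.prems(1) by blast
    then show ?thesis by blast
  next
    case False
    have card_le: "card X \<le> card (E `` X)" if "X \<subseteq> L" for X
      using psubset.prems(2) that by (simp add: hall_condition_def)
    have "\<exists>y. (x, y) \<in> E" if "x \<in> L" for x
      using card_le[of "{x}"] that by (cases "E `` {x} = {}") auto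
    then obtain f where f: "\<And>x. x \<in> L \<Longrightarrow> (x, f x) \<in> E" by metis
    have "inj_on f L"
    proof (rule inj_onI, rule ccontr)
      fix x x' assume x: "x \<in> L" "x' \<in> L" "f x = f x'" "x \<noteq> x'"
      have "y = f z" if "(z, y) \<in> E" "z \<in> L" for z y
        using False f that by blast
      then have "E `` {x, x'} = {f x}" using f x by auto
      then show False using card_le[of "{x, x'}"] x by simp
    qed
    then show ?thesis using f by blast
  qed
qed

definition feasible_dual ::
  "('a \<times> 'b) set \<Rightarrow> ('a \<Rightarrow> 'b \<Rightarrow> int) \<Rightarrow> ('a \<Rightarrow> int) \<Rightarrow> ('b \<Rightarrow> int) \<Rightarrow> bool" where
  "feasible_dual E w u v \<longleftrightarrow> (\<forall>(x, y)\<in>E. w x y \<le> u x + v y)"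

lemma feasible_dualD: "feasible_dual E w u v \<Longrightarrow> (x, y) \<in> E \<Longrightarrow> w x y \<le> u x + v y"
  by (auto simp: feasible_dual_def)

lemma feasible_dual_mono:
  "feasible_dual E w u v \<Longrightarrow> (\<And>x y. (x, y) \<in> E \<Longrightarrow> w' x y \<le> w x y) \<Longrightarrow>
    feasible_dual E w' u v"
  unfolding feasible_dual_def by fastforce

lemma feasible_dual_ge_assignment:
  assumes "feasible_dual E w u v" and "bij_betw g L R" and "\<forall>x\<in>L. (x, g x) \<in> E"
  shows "(\<Sum>x\<in>L. w x (g x)) \<le> sum u L + sum v R"
proof -
  have "(\<Sum>x\<in>L. w x (g x)) \<le> (\<Sum>x\<in>L. u x + v (g x))"
    using assms(1,3) by (intro sum_mono feasible_dualD) auto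
  also have "\<dots> = sum u L + sum v R"
    using sum.reindex_bij_betw[OF assms(2), of v] by (simp add: sum.distrib)
  finally show ?thesis .
qed

lemma optimal_dual_exists:
  assumes "finite R" and "E \<subseteq> L \<times> R"
    and "bij_betw g L R" and "\<forall>x\<in>L. (x, g x) \<in> E"
  obtains u v where "feasible_dual E w u v"
    and "\<And>u' v'. feasible_dual E w u' v' \<Longrightarrow> sum u L + sum v R \<le> sum u' L + sum v' R"
proof -
  let ?feasible = "\<lambda>(u, v). feasible_dual E w u v"
  define excess where
    "excess = (\<lambda>(u, v). nat (sum u L + sum v R - (\<Sum>x\<in>L. w x (g x))))"
  have "w x y \<le> (\<Sum>y\<in>R. \<bar>w x y\<bar>)" if "(x, y) \<in> E" for x y
  proof -
    have "\<bar>w x y\<bar> \<le> (\<Sum>y\<in>R. \<bar>w x y\<bar>)"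
      using that assms(1,2) by (intro member_le_sum) auto
    then show ?thesis by linarith
  qed
  then have "?feasible (\<lambda>x. \<Sum>y\<in>R. \<bar>w x y\<bar>, \<lambda>_. 0)"
    by (auto simp: feasible_dual_def)
  then obtain p where p: "?feasible p" "\<And>q. ?feasible q \<Longrightarrow> excess p \<le> excess q"
    using ex_has_least_nat[of ?feasible _ excess] by blast
  obtain u v where "p = (u, v)" by fastforce
  with p have uv: "feasible_dual E w u v"
      and least: "\<And>q. ?feasible q \<Longrightarrow> excess (u, v) \<le> excess q"
    by auto
  have "sum u L + sum v R \<le> sum u' L + sum v' R" if "feasible_dual E w u' v'" for u' v'
    using least[of "(u', v')"] that feasible_dual_ge_assignment[OF uv assms(3,4)]
      feasible_dual_ge_assignment[OF that assms(3,4)]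
    by (simp add: excess_def)
  with uv show thesis by (rule that)
qed

text \<open>A Hall violator \<open>X\<close> among the tight edges could be used to decrease the dual value.\<close>

lemma optimal_dual_tight_hall_condition:
  assumes fin: "finite L" "finite R" and E: "E \<subseteq> L \<times> R" and uv: "feasible_dual E w u v"
    and optimal: "\<And>u' v'. feasible_dual E w u' v' \<Longrightarrow> sum u L + sum v R \<le> sum u' L + sum v' R"
  shows "hall_condition L {(x, y) \<in> E. u x + v y = w x y}"
  unfolding hall_condition_def
proof (intro allI impI)
  let ?T = "{(x, y) \<in> E. u x + v y = w x y}"
  fix X assume X: "X \<subseteq> L"
  define Y where "Y = ?T `` X"
  let ?u = "\<lambda>x. u x - of_bool (x \<in> X)" and ?v = "\<lambda>y. v y + of_bool (y \<in> Y)"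
  have "w x y \<le> ?u x + ?v y" if "(x, y) \<in> E" for x y
  proof -
    have "w x y \<le> u x + v y" using uv that by (rule feasible_dualD)
    moreover have "u x + v y \<noteq> w x y" if "x \<in> X" "y \<notin> Y"
      using that \<open>(x, y) \<in> E\<close> by (auto simp: Y_def)
    ultimately show ?thesis by auto
  qed
  then have "sum u L + sum v R \<le> sum ?u L + sum ?v R"
    by (intro optimal) (unfold feasible_dual_def, blast)
  moreover have "Y \<subseteq> R" using E by (auto simp: Y_def)
  ultimately show "card X \<le> card Y"
    using X fin by (simp add: sum_subtractf sum.distrib inf_absorb2)
qed

theorem assignment_duality:
  assumes fin: "finite L" "finite R" and E: "E \<subseteq> L \<times> R"
    and g: "bij_betw g L R" "\<forall>x\<in>L. (x, g x) \<in> E"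
  obtains f u v where "bij_betw f L R" "\<forall>x\<in>L. (x, f x) \<in> E"
    "feasible_dual E w u v" "sum u L + sum v R = (\<Sum>x\<in>L. w x (f x))"
proof -
  obtain u v where uv: "feasible_dual E w u v"
      and optimal: "\<And>u' v'. feasible_dual E w u' v' \<Longrightarrow> sum u L + sum v R \<le> sum u' L + sum v' R"
    using optimal_dual_exists[OF fin(2) E g] by blast
  let ?T = "{(x, y) \<in> E. u x + v y = w x y}"
  have "finite ?T"
    by (rule finite_subset[of _ "L \<times> R"]) (use E fin in auto)
  then obtain f where f: "inj_on f L" "\<forall>x\<in>L. (x, f x) \<in> ?T"
    using hall_marriage[OF _ fin(1) optimal_dual_tight_hall_condition[OF fin E uv optimal]] by blast
  have "card (f ` L) = card R"
    using card_image[OF f(1)] bij_betw_same_card[OF g(1)] by simp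
  moreover have "f ` L \<subseteq> R" using f(2) E by auto
  ultimately have bij: "bij_betw f L R"
    using f(1) fin(2) by (simp add: bij_betw_def card_subset_eq)
  have "sum u L + sum v R = (\<Sum>x\<in>L. u x + v (f x))"
    using sum.reindex_bij_betw[OF bij, of v] by (simp add: sum.distrib)
  also have "\<dots> = (\<Sum>x\<in>L. w x (f x))"
    using f(2) by (intro sum.cong) auto
  finally show thesis using that bij f(2) uv by blast
qed

definition matching :: "('a \<times> 'b) set \<Rightarrow> ('a \<times> 'b) set \<Rightarrow> bool" where
  "matching E M \<longleftrightarrow> M \<subseteq> E \<and> single_valued M \<and> single_valued (M\<inverse>)"

lemma matching_right_unique: "matching E M \<Longrightarrow> (x, y) \<in> M \<Longrightarrow> (x, y') \<in> M \<Longrightarrow> y = y'"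
  by (auto simp: matching_def dest: single_valuedD)

lemma matching_left_unique: "matching E M \<Longrightarrow> (x, y) \<in> M \<Longrightarrow> (x', y) \<in> M \<Longrightarrow> x = x'"
  by (auto simp: matching_def dest: single_valuedD)

lemma matching_converse: "matching E M \<Longrightarrow> matching (E\<inverse>) (M\<inverse>)"
  by (auto simp: matching_def)

lemma matching_subset: "matching E M \<Longrightarrow> M' \<subseteq> M \<Longrightarrow> M' \<subseteq> E' \<Longrightarrow> matching E' M'"
  unfolding matching_def single_valued_def by blast

lemma finite_matching:
  "matching E M \<Longrightarrow> E \<subseteq> L \<times> R \<Longrightarrow> finite L \<Longrightarrow> finite R \<Longrightarrow> finite M"
  by (meson finite_SigmaI finite_subset matching_def)

lemma card_uncovered_left:
  assumes M: "matching E M" and "E \<subseteq> L \<times> R" and "finite L"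
  shows "int (card (L - Domain M)) = int (card L) - int (card M)"
proof -
  have "inj_on fst M" using M by (auto intro!: inj_onI dest: matching_right_unique)
  then have "card (Domain M) = card M" by (simp add: Domain_fst card_image)
  moreover have sub: "Domain M \<subseteq> L" using assms by (auto simp: matching_def)
  then have "finite (Domain M)" using \<open>finite L\<close> by (rule finite_subset)
  ultimately show ?thesis
    using card_mono[OF \<open>finite L\<close> sub] sub by (simp add: card_Diff_subset of_nat_diff)
qed

lemma card_uncovered_right:
  assumes "matching E M" and "E \<subseteq> L \<times> R" and "finite R"
  shows "int (card (R - Range M)) = int (card R) - int (card M)"
  using card_uncovered_left[OF matching_converse[OF assms(1)], of R L] assms(2,3)
  by (auto simp: Domain_converse)

text \<open>
  Each vertex that \<open>N\<close> leaves uncovered gets a dummy partner, which may be used by any vertex of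
  the other side. Perfect matchings of the padded graph then correspond to matchings of \<open>E\<close> with
  at least \<open>card N\<close> edges.
\<close>

definition padded_left :: "'a set \<Rightarrow> 'b set \<Rightarrow> ('a \<times> 'b) set \<Rightarrow> ('a + 'b) set" where
  "padded_left L R N = L <+> (R - Range N)"

definition padded_right :: "'a set \<Rightarrow> 'b set \<Rightarrow> ('a \<times> 'b) set \<Rightarrow> ('b + 'a) set" where
  "padded_right L R N = R <+> (L - Domain N)"

definition padded_edges ::
  "'a set \<Rightarrow> 'b set \<Rightarrow> ('a \<times> 'b) set \<Rightarrow> ('a \<times> 'b) set \<Rightarrow> (('a + 'b) \<times> ('b + 'a)) set" where
  "padded_edges L R N E = {(p, q) \<in> padded_left L R N \<times> padded_right L R N.
     \<forall>x y. p = Inl x \<and> q = Inl y \<longrightarrow> (x, y) \<in> E}"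

definition padded_weight :: "('a \<Rightarrow> 'b \<Rightarrow> int) \<Rightarrow> 'a + 'b \<Rightarrow> 'b + 'a \<Rightarrow> int" where
  "padded_weight w p q = (case (p, q) of (Inl x, Inl y) \<Rightarrow> w x y | _ \<Rightarrow> 0)"

lemma padded_weight_simps [simp]:
  "padded_weight w (Inl x) (Inl y) = w x y"
  "padded_weight w (Inr i) q = 0"
  "padded_weight w p (Inr j) = 0"
  by (auto simp: padded_weight_def split: sum.split)

lemma mem_padded [simp]:
  "Inl x \<in> padded_left L R N \<longleftrightarrow> x \<in> L"
  "Inr y \<in> padded_left L R N \<longleftrightarrow> y \<in> R - Range N"
  "Inl y \<in> padded_right L R N \<longleftrightarrow> y \<in> R"
  "Inr x \<in> padded_right L R N \<longleftrightarrow> x \<in> L - Domain N"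
  by (auto simp: padded_left_def padded_right_def)

lemma padded_assignment_exists:
  assumes N: "matching E N" and E: "E \<subseteq> L \<times> R"
  obtains g where "bij_betw g (padded_left L R N) (padded_right L R N)"
    and "\<forall>p\<in>padded_left L R N. (p, g p) \<in> padded_edges L R N E"
proof -
  have "\<forall>x\<in>Domain N. \<exists>y. (x, y) \<in> N" "\<forall>y\<in>Range N. \<exists>x. (x, y) \<in> N" by auto
  then obtain a b where a: "\<And>x. x \<in> Domain N \<Longrightarrow> (x, a x) \<in> N"
      and b: "\<And>y. y \<in> Range N \<Longrightarrow> (b y, y) \<in> N"
    by metis
  have ab: "b (a x) = x" if "x \<in> Domain N" for x
    using a[OF that] b[of "a x"] matching_left_unique[OF N] by blast
  have ba: "a (b y) = y" if "y \<in> Range N" for y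
    using b[OF that] a[of "b y"] matching_right_unique[OF N] by blast
  have N_sub: "N \<subseteq> L \<times> R" using N E by (auto simp: matching_def)
  let ?g = "case_sum (\<lambda>x. if x \<in> Domain N then Inl (a x) else Inr x) Inl"
  let ?g' = "case_sum (\<lambda>y. if y \<in> Range N then Inl (b y) else Inr y) Inl"
  have edge: "(p, ?g p) \<in> padded_edges L R N E" if "p \<in> padded_left L R N" for p
    using that a[THEN RangeI] a N N_sub by (cases p) (auto simp: padded_edges_def matching_def)
  moreover have "bij_betw ?g (padded_left L R N) (padded_right L R N)"
  proof (rule bij_betw_byWitness)
    show "\<forall>p\<in>padded_left L R N. ?g' (?g p) = p"
      using a[THEN RangeI] ab by (auto simp: padded_left_def)
    show "\<forall>q\<in>padded_right L R N. ?g (?g' q) = q"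
      using b[THEN DomainI] ba by (auto simp: padded_right_def)
    show "?g ` padded_left L R N \<subseteq> padded_right L R N"
      using edge by (auto simp: padded_edges_def)
    show "?g' ` padded_right L R N \<subseteq> padded_left L R N"
      using b N_sub by (force simp: padded_right_def)
  qed
  ultimately show thesis using that by blast
qed

definition padded_restriction :: "'a set \<Rightarrow> ('a + 'b \<Rightarrow> 'b + 'a) \<Rightarrow> ('a \<times> 'b) set" where
  "padded_restriction L f = {(x, y). x \<in> L \<and> f (Inl x) = Inl y}"

lemma matching_padded_restriction:
  assumes f: "inj_on f (padded_left L R N)"
      "\<forall>p\<in>padded_left L R N. (p, f p) \<in> padded_edges L R N E"
  shows "matching E (padded_restriction L f)"
proof -
  have "padded_restriction L f \<subseteq> E"
    using f(2) by (force simp: padded_restriction_def padded_edges_def)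
  moreover have "single_valued ((padded_restriction L f)\<inverse>)"
  proof (rule single_valuedI)
    fix y x x'
    assume "(y, x) \<in> (padded_restriction L f)\<inverse>" "(y, x') \<in> (padded_restriction L f)\<inverse>"
    then show "x = x'"
      using inj_onD[OF f(1), of "Inl x" "Inl x'"] by (simp add: padded_restriction_def)
  qed
  moreover have "single_valued (padded_restriction L f)"
    by (auto simp: padded_restriction_def single_valued_def)
  ultimately show ?thesis by (simp add: matching_def)
qed

lemma card_padded_restriction:
  assumes "finite L" and N: "matching E N" and E: "E \<subseteq> L \<times> R"
    and f: "inj_on f (padded_left L R N)"
      "\<forall>p\<in>padded_left L R N. (p, f p) \<in> padded_edges L R N E"
  shows "card N \<le> card (padded_restriction L f)"
proof -
  let ?M = "padded_restriction L f"
  have "\<exists>j. f (Inl x) = Inr j \<and> j \<in> L - Domain N" if "x \<in> L - Domain ?M" for x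
    using bspec[OF f(2), of "Inl x"] that
    by (cases "f (Inl x)") (auto simp: padded_restriction_def padded_edges_def)
  then obtain j where j: "\<And>x. x \<in> L - Domain ?M \<Longrightarrow> f (Inl x) = Inr (j x) \<and> j x \<in> L - Domain N"
    by metis
  have "inj_on j (L - Domain ?M)"
  proof (rule inj_onI)
    fix x x' assume "x \<in> L - Domain ?M" "x' \<in> L - Domain ?M" "j x = j x'"
    then show "x = x'" using j inj_onD[OF f(1), of "Inl x" "Inl x'"] by simp
  qed
  then have "card (L - Domain ?M) \<le> card (L - Domain N)"
    using j \<open>finite L\<close> by (intro card_inj_on_le[of j]) auto
  then show ?thesis
    using card_uncovered_left[OF matching_padded_restriction[OF f] E \<open>finite L\<close>]
      card_uncovered_left[OF N E \<open>finite L\<close>]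
    by linarith
qed

lemma sum_padded_weight:
  assumes "finite L" and "finite R"
  shows "(\<Sum>p\<in>padded_left L R N. padded_weight w p (f p))
    = (\<Sum>(x, y)\<in>padded_restriction L f. w x y)"
proof -
  let ?M = "padded_restriction L f"
  have "(\<Sum>p\<in>padded_left L R N. padded_weight w p (f p))
      = (\<Sum>x\<in>L. padded_weight w (Inl x) (f (Inl x)))"
    unfolding padded_left_def using assms by (simp add: sum.Plus)
  also have "\<dots> = (\<Sum>x\<in>fst ` ?M. padded_weight w (Inl x) (f (Inl x)))"
    using assms(1) by (intro sum.mono_neutral_right)
      (force simp: padded_restriction_def padded_weight_def split: sum.split)+
  also have "\<dots> = (\<Sum>(x, y)\<in>?M. w x y)"
    by (subst sum.reindex) (auto simp: padded_restriction_def inj_on_def intro!: sum.cong)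
  finally show ?thesis .
qed

lemma ex_separating_point:
  fixes A B :: "'a :: linorder set"
  assumes "finite A" and "finite B" and "\<And>a b. a \<in> A \<Longrightarrow> b \<in> B \<Longrightarrow> a \<le> b"
  obtains c where "\<And>a. a \<in> A \<Longrightarrow> a \<le> c" and "\<And>b. b \<in> B \<Longrightarrow> c \<le> b"
proof (cases "B = {}")
  case True
  then show thesis using assms(1) that[of "Max A"] by auto
next
  case False
  then show thesis using assms that[of "Min B"] by auto
qed

text \<open>
  A dummy may be matched with every vertex of the other side, so a single price below those of all
  the dummies on a side still makes up for every potential on the other side.
\<close>

lemma uniform_dummy_prices:
  assumes fin: "finite L" "finite R"
    and uv: "feasible_dual (padded_edges L R N E) (padded_weight w) u v"
  obtains a b where "0 \<le> a + b"
    and "\<forall>y\<in>R. 0 \<le> v (Inl y) + a" and "\<forall>i\<in>R - Range N. a \<le> u (Inr i)"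
    and "\<forall>x\<in>L. 0 \<le> u (Inl x) + b" and "\<forall>j\<in>L - Domain N. b \<le> v (Inr j)"
proof -
  have left_dummy: "0 \<le> u (Inr i) + v q" if "i \<in> R - Range N" "q \<in> padded_right L R N" for i q
    using feasible_dualD[OF uv, of "Inr i" q] that by (simp add: padded_edges_def)
  have right_dummy: "0 \<le> u (Inl x) + v (Inr j)" if "x \<in> L" "j \<in> L - Domain N" for x j
    using feasible_dualD[OF uv, of "Inl x" "Inr j"] that by (simp add: padded_edges_def)
  let ?A = "(\<lambda>q. - v q) ` padded_right L R N" and ?A' = "(\<lambda>i. u (Inr i)) ` (R - Range N)"
  obtain a where a: "\<And>s. s \<in> ?A \<Longrightarrow> s \<le> a" "\<And>t. t \<in> ?A' \<Longrightarrow> a \<le> t"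
  proof (rule ex_separating_point)
    show "finite ?A" "finite ?A'" using fin by (simp_all add: padded_right_def)
    show "s \<le> t" if "s \<in> ?A" "t \<in> ?A'" for s t
      using that left_dummy by fastforce
  qed blast
  let ?B = "insert (- a) ((\<lambda>x. - u (Inl x)) ` L)" and ?B' = "(\<lambda>j. v (Inr j)) ` (L - Domain N)"
  obtain b where b: "\<And>s. s \<in> ?B \<Longrightarrow> s \<le> b" "\<And>t. t \<in> ?B' \<Longrightarrow> b \<le> t"
  proof (rule ex_separating_point)
    show "finite ?B" "finite ?B'" using fin by simp_all
    show "s \<le> t" if "s \<in> ?B" "t \<in> ?B'" for s t
      using that right_dummy a(1)[OF imageI, of "Inr _"] by fastforce
  qed blast
  have "0 \<le> v (Inl y) + a" if "y \<in> R" for y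
    using a(1)[OF imageI, of "Inl y"] that by simp
  moreover have "0 \<le> u (Inl x) + b" if "x \<in> L" for x
    using b(1)[of "- u (Inl x)"] that by simp
  moreover have "0 \<le> a + b" using b(1)[of "- a"] by simp
  ultimately show thesis using a(2) b(2) by (intro that[of a b]) auto
qed

lemma dual_of_padded_dual:
  assumes fin: "finite L" "finite R" and N: "matching E N" and E: "E \<subseteq> L \<times> R"
    and uv: "feasible_dual (padded_edges L R N E) (padded_weight w) u v"
  obtains slope u' v' where "0 \<le> slope" and "\<forall>x\<in>L. 0 \<le> u' x" and "\<forall>y\<in>R. 0 \<le> v' y"
    and "feasible_dual E (\<lambda>x y. w x y + slope) u' v'"
    and "sum u' L + sum v' R
      \<le> sum u (padded_left L R N) + sum v (padded_right L R N) + slope * int (card N)"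
proof -
  obtain a b where slope: "0 \<le> a + b"
    and a: "\<forall>y\<in>R. 0 \<le> v (Inl y) + a" "\<forall>i\<in>R - Range N. a \<le> u (Inr i)"
    and b: "\<forall>x\<in>L. 0 \<le> u (Inl x) + b" "\<forall>j\<in>L - Domain N. b \<le> v (Inr j)"
    by (rule uniform_dummy_prices[OF fin uv])
  let ?u = "\<lambda>x. u (Inl x) + b" and ?v = "\<lambda>y. v (Inl y) + a"
  have "w x y \<le> u (Inl x) + v (Inl y)" if "(x, y) \<in> E" for x y
    using feasible_dualD[OF uv, of "Inl x" "Inl y"] that E by (auto simp: padded_edges_def)
  then have "feasible_dual E (\<lambda>x y. w x y + (a + b)) ?u ?v"
    by (auto simp: feasible_dual_def algebra_simps)
  moreover have "int (card (R - Range N)) * a \<le> (\<Sum>i\<in>R - Range N. u (Inr i))"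
    using sum_bounded_below[of "R - Range N" a] a(2) by simp
  moreover have "int (card (L - Domain N)) * b \<le> (\<Sum>j\<in>L - Domain N. v (Inr j))"
    using sum_bounded_below[of "L - Domain N" b] b(2) by simp
  ultimately show thesis
    using slope a(1) b(1) fin card_uncovered_left[OF N E fin(1)] card_uncovered_right[OF N E fin(2)]
    by (intro that[of "a + b" ?u ?v])
      (simp_all add: padded_left_def padded_right_def sum.Plus sum.distrib algebra_simps)
qed

text \<open>\<open>slope\<close> is the multiplier of the constraint that a matching has at least \<open>card N\<close> edges.\<close>

theorem matching_duality:
  assumes fin: "finite L" "finite R" and E: "E \<subseteq> L \<times> R" and N: "matching E N"
  obtains M slope u v where "matching E M" "card N \<le> card M" "0 \<le> slope"
    "\<forall>x\<in>L. 0 \<le> u x" "\<forall>y\<in>R. 0 \<le> v y"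
    "feasible_dual E (\<lambda>x y. w x y + slope) u v"
    "sum u L + sum v R \<le> (\<Sum>(x, y)\<in>M. w x y) + slope * int (card N)"
proof -
  obtain g where g: "bij_betw g (padded_left L R N) (padded_right L R N)"
      "\<forall>p\<in>padded_left L R N. (p, g p) \<in> padded_edges L R N E"
    using padded_assignment_exists[OF N E] by blast
  have finite_padded: "finite (padded_left L R N)" "finite (padded_right L R N)"
    using fin by (simp_all add: padded_left_def padded_right_def)
  have padded_sub: "padded_edges L R N E \<subseteq> padded_left L R N \<times> padded_right L R N"
    by (auto simp: padded_edges_def)
  obtain f u v where f: "bij_betw f (padded_left L R N) (padded_right L R N)"
      "\<forall>p\<in>padded_left L R N. (p, f p) \<in> padded_edges L R N E"
    and uv: "feasible_dual (padded_edges L R N E) (padded_weight w) u v"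
      "sum u (padded_left L R N) + sum v (padded_right L R N)
        = (\<Sum>p\<in>padded_left L R N. padded_weight w p (f p))"
    by (rule assignment_duality[OF finite_padded padded_sub g, of "padded_weight w"])
  have f': "inj_on f (padded_left L R N)"
      "\<forall>p\<in>padded_left L R N. (p, f p) \<in> padded_edges L R N E"
    using f by (auto simp: bij_betw_def)
  obtain slope u' v' where "0 \<le> slope" "\<forall>x\<in>L. 0 \<le> u' x" "\<forall>y\<in>R. 0 \<le> v' y"
    "feasible_dual E (\<lambda>x y. w x y + slope) u' v'"
    "sum u' L + sum v' R
      \<le> sum u (padded_left L R N) + sum v (padded_right L R N) + slope * int (card N)"
    by (rule dual_of_padded_dual[OF fin N E uv(1)])
  then show thesis
    using that[OF matching_padded_restriction[OF f'] card_padded_restriction[OF fin(1) N E f']]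
      uv(2) sum_padded_weight[OF fin] by simp
qed

section \<open>Conjugate partitions from tight pairs\<close>

definition increment :: "(nat \<Rightarrow> int) \<Rightarrow> nat \<Rightarrow> int" where
  "increment A k = A k - A (k - 1)"

lemma increment_Suc [simp]: "increment A (Suc k) = A (Suc k) - A k"
  by (simp add: increment_def)

locale tight_pairs =
  fixes A D :: "nat \<Rightarrow> int" and n :: nat
  assumes A0: "A 0 = 0" and D0: "D 0 = 0"
    and weak: "\<And>k l. A k + D l \<le> int n + int k * int l"
    and tight_A: "\<And>k. \<exists>l. A k + D l = int n + int k * int l"
    and tight_D: "\<And>l. \<exists>k. A k + D l = int n + int k * int l"
begin

lemma increment_Suc_le_if_tight:
  assumes "A k + D l = int n + int k * int l"
  shows "increment A (Suc k) \<le> int l"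
  using assms weak[of "Suc k" l] by (simp add: algebra_simps)

lemma le_increment_if_tight:
  assumes "A k + D l = int n + int k * int l" and "1 \<le> k"
  shows "int l \<le> increment A k"
  using assms weak[of "k - 1" l] by (simp add: increment_def algebra_simps of_nat_diff)

lemma increment_nonneg: "1 \<le> k \<Longrightarrow> 0 \<le> increment A k"
  using tight_A[of k] le_increment_if_tight[of k] by force

lemma increment_Suc_le: "1 \<le> k \<Longrightarrow> increment A (Suc k) \<le> increment A k"
  using tight_A[of k] le_increment_if_tight[of k] increment_Suc_le_if_tight[of k] by force

lemma increment_lower_bound:
  assumes "k \<le> i" and "a \<le> increment A i"
  shows "A k + (int i - int k) * a \<le> A i"
  using assms
proof (induction i rule: dec_induct)
  case (step i)
  then have "a \<le> increment A i" if "k < i"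
    using increment_Suc_le[of i] that by simp
  then have "A k + (int i - int k) * a \<le> A i"
    using step by (cases "k = i") simp_all
  then show ?case using step.prems by (simp add: algebra_simps)
qed simp

lemma sum_increment: "(\<Sum>k = 1..m. increment A k) = A m"
  by (induction m) (simp_all add: A0)

lemma eventually_total: obtains m where "\<forall>k\<ge>m. A k = int n"
proof -
  obtain m where m: "A m = int n"
    using tight_D[of 0] D0 by auto
  have "A k = int n" if "m \<le> k" for k
    using that
  proof (induction k rule: dec_induct)
    case (step k)
    then show ?case using increment_nonneg[of "Suc k"] weak[of "Suc k" 0] D0 by simp
  qed (rule m)
  then show thesis using that by blast
qed

lemma is_partition_increment:
  assumes lam: "\<And>k. 1 \<le> k \<Longrightarrow> lam k = increment A k"
  shows "is_partition n lam"
proof -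
  obtain m where total: "\<forall>k\<ge>m. A k = int n" by (rule eventually_total)
  have support: "{k. 1 \<le> k \<and> lam k \<noteq> 0} \<subseteq> {1..m}"
  proof
    fix k assume "k \<in> {k. 1 \<le> k \<and> lam k \<noteq> 0}"
    then have "1 \<le> k" "A k \<noteq> A (k - 1)" using lam[of k] by (auto simp: increment_def)
    then have "\<not> m \<le> k - 1" using total by auto
    then show "k \<in> {1..m}" using \<open>1 \<le> k\<close> by simp
  qed
  then have "(\<Sum>k | 1 \<le> k \<and> lam k \<noteq> 0. lam k) = (\<Sum>k = 1..m. lam k)"
    by (intro sum.mono_neutral_left) auto
  also have "\<dots> = int n"
    using lam sum_increment[of m] total by simp
  finally have "(\<Sum>k | 1 \<le> k \<and> lam k \<noteq> 0. lam k) = int n" .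
  moreover have "finite {k. 1 \<le> k \<and> lam k \<noteq> 0}"
    using support by (rule finite_subset) simp
  ultimately show ?thesis
    using increment_nonneg increment_Suc_le lam unfolding is_partition_def by fastforce
qed

end

sublocale tight_pairs \<subseteq> swap: tight_pairs D A n
proof
  show "D k + A l \<le> int n + int k * int l" for k l
    using weak[of l k] by (simp add: algebra_simps)
  show "\<exists>l. D k + A l = int n + int k * int l" for k
    using tight_D[of k] by (simp add: algebra_simps)
  show "\<exists>k. D k + A l = int n + int k * int l" for l
    using tight_A[of l] by (simp add: algebra_simps)
qed (rule D0 A0)+

lemma (in tight_pairs) le_increment_swap:
  assumes "1 \<le> i" and "1 \<le> j" and j_le: "int j \<le> increment A i"
  shows "int i \<le> increment D j"
proof -
  obtain k where k: "A k + D j = int n + int k * int j"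
    using tight_D by blast
  show ?thesis
  proof (cases "i \<le> k")
    case True
    have "int k \<le> increment D j"
      using swap.le_increment_if_tight[of j k] k assms(2) by (simp add: algebra_simps)
    then show ?thesis using True by simp
  next
    case False
    then have "A k + (int i - int k) * int j \<le> A i"
      using j_le by (intro increment_lower_bound) auto
    then have "A i + D j = int n + int i * int j"
      using k weak[of i j] by (simp add: algebra_simps)
    then show ?thesis
      using swap.le_increment_if_tight[of j i] assms(2) by (simp add: algebra_simps)
  qed
qed

lemma (in tight_pairs) conjugate_of_increment:
  assumes lam: "\<And>k. 1 \<le> k \<Longrightarrow> lam k = increment A k"
    and mu: "\<And>k. 1 \<le> k \<Longrightarrow> mu k = increment D k"
  shows "conjugate_of mu lam"
  unfolding conjugate_of_def
proof (intro allI impI)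
  fix j :: nat assume j: "1 \<le> j"
  have "int j \<le> lam i \<longleftrightarrow> int i \<le> mu j" if "1 \<le> i" for i
    using le_increment_swap[of i j] swap.le_increment_swap[of j i] that j lam mu by auto
  then have "{i. 1 \<le> i \<and> int j \<le> lam i} = {1..nat (mu j)}"
    by auto
  then show "mu j = int (card {i. 1 \<le> i \<and> int j \<le> lam i})"
    using swap.increment_nonneg[of j] mu j by simp
qed

section \<open>Ascents and descents of lists\<close>

lemma asc_Nil [simp]: "asc r [] = 0"
  by (simp add: asc_def)

lemma asc_singleton [simp]: "asc r [x] = 1"
  by (simp add: asc_def)

lemma asc_Cons_Cons [simp]:
  "asc r (x # y # ys) = asc r (y # ys) + of_bool ((x, y) \<in> r - Id)"
proof -
  let ?J = "\<lambda>xs. {j. Suc j < length xs \<and> (xs ! j, xs ! Suc j) \<in> r - Id}"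
  have "?J (x # y # ys) = (if (x, y) \<in> r - Id then {0} else {}) \<union> Suc ` ?J (y # ys)"
  proof (rule set_eqI)
    fix j show "j \<in> ?J (x # y # ys) \<longleftrightarrow>
      j \<in> (if (x, y) \<in> r - Id then {0} else {}) \<union> Suc ` ?J (y # ys)"
      by (cases j) auto
  qed
  moreover have "finite (?J (y # ys))"
    by (rule finite_subset[of _ "{..length (y # ys)}"]) auto
  ultimately have "card (?J (x # y # ys)) = card (?J (y # ys)) + of_bool ((x, y) \<in> r - Id)"
    by (simp add: card_image card_insert_if image_iff)
  then show ?thesis by (simp add: asc_def)
qed

lemma asc_Cons_le: "asc r (x # xs) \<le> Suc (asc r xs)"
  by (cases xs) auto

lemma asc_remove_second:
  assumes "trans (r - Id)"
  shows "asc r (x # y # ys) \<le> Suc (asc r (x # ys))"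
proof (cases ys)
  case (Cons z zs)
  have "(x, z) \<in> r - Id" if "(x, y) \<in> r - Id" "(y, z) \<in> r - Id"
    using assms that by (rule transD)
  then show ?thesis using Cons by (auto simp: of_bool_def)
qed simp

lemma asc_Cons_filter:
  assumes "trans (r - Id)"
  shows "asc r (x # xs) \<le> length (filter (\<lambda>y. \<not> P y) xs) + asc r (x # filter P xs)"
proof (induction xs arbitrary: x)
  case (Cons y ys)
  show ?case
  proof (cases "P y")
    case True
    then show ?thesis using Cons.IH[of y] by simp
  next
    case False
    have "asc r (x # y # ys) \<le> Suc (asc r (x # ys))"
      by (rule asc_remove_second[OF assms])
    also have "\<dots> \<le> Suc (length (filter (\<lambda>y. \<not> P y) ys) + asc r (x # filter P ys))"
      using Cons.IH[of x] by simp
    finally show ?thesis using False by simp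
  qed
qed simp

lemma asc_filter:
  assumes "trans (r - Id)"
  shows "asc r xs \<le> length (filter (\<lambda>y. \<not> P y) xs) + asc r (filter P xs)"
proof (induction xs)
  case (Cons x xs)
  then show ?case
    using asc_Cons_le[of r x xs] asc_Cons_filter[OF assms, of x xs P] by (cases "P x") auto
qed simp

lemma asc_le_length_remdups_adj:
  "successively (\<lambda>x y. (x, y) \<in> r - Id \<longrightarrow> c x \<noteq> c y) xs \<Longrightarrow>
    asc r xs \<le> length (remdups_adj (map c xs))"
  by (induction xs rule: induct_list012) auto

lemma distinct_remdups_adj_map:
  assumes "sorted_wrt R xs"
    and "\<And>x y z. {x, y, z} \<subseteq> set xs \<Longrightarrow> R x y \<Longrightarrow> R y z \<Longrightarrow> c x = c z \<Longrightarrow> c x = c y"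
  shows "distinct (remdups_adj (map c xs))"
  using assms
proof (induction xs rule: induct_list012)
  case (3 x y ys)
  have IH: "distinct (remdups_adj (map c (y # ys)))"
    using "3.prems" by (intro "3.IH"(2)) auto
  show ?case
  proof (cases "c x = c y")
    case False
    have "c x \<noteq> c z" if "z \<in> set ys" for z
      using "3.prems"(2)[of x y z] "3.prems"(1) that False by auto
    then show ?thesis using IH False by auto
  qed (use IH in simp)
qed simp_all

text \<open>
  Restricting a chain to \<open>X\<close> loses at most one ascent per deleted element, and the ascents that
  remain happen only where the label changes.
\<close>

lemma asc_le_card_labels:
  assumes "trans (r - Id)" and "sorted_wrt R xs"
    and antichain: "\<And>x y. {x, y} \<subseteq> X \<Longrightarrow> R x y \<Longrightarrow> c x = c y \<Longrightarrow> (x, y) \<notin> r"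
    and convex: "\<And>x y z. {x, y, z} \<subseteq> X \<Longrightarrow> R x y \<Longrightarrow> R y z \<Longrightarrow> c x = c z \<Longrightarrow> c x = c y"
  shows "asc r xs \<le> length (filter (\<lambda>x. x \<notin> X) xs) + card (c ` (set xs \<inter> X))"
proof -
  let ?zs = "filter (\<lambda>x. x \<in> X) xs"
  have sorted: "sorted_wrt R ?zs" using assms(2) by (rule sorted_wrt_filter)
  have "successively (\<lambda>x y. (x, y) \<in> r - Id \<longrightarrow> c x \<noteq> c y) ?zs"
    using antichain by (intro successively_if_sorted_wrt sorted_wrt_mono_rel[OF _ sorted]) auto
  then have "asc r ?zs \<le> length (remdups_adj (map c ?zs))"
    by (rule asc_le_length_remdups_adj)
  also have "distinct (remdups_adj (map c ?zs))"
    using convex by (intro distinct_remdups_adj_map[OF sorted]) auto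
  then have "length (remdups_adj (map c ?zs)) = card (set (remdups_adj (map c ?zs)))"
    by (simp only: distinct_card)
  also have "set (remdups_adj (map c ?zs)) = c ` (set xs \<inter> X)" by auto
  finally show ?thesis
    using asc_filter[OF assms(1), of xs "\<lambda>x. x \<in> X"] by linarith
qed

definition steps :: "'a list \<Rightarrow> ('a \<times> 'a) set" where
  "steps xs = set (zip xs (tl xs))"

lemma steps_simps [simp]:
  "steps [] = {}"
  "steps [x] = {}"
  "steps (x # y # ys) = insert (x, y) (steps (y # ys))"
  by (simp_all add: steps_def)

lemma finite_steps [simp]: "finite (steps xs)"
  by (simp add: steps_def)

lemma steps_subset: "steps xs \<subseteq> set xs \<times> set xs"
  by (induction xs rule: induct_list012) auto

lemma successively_iff_steps: "successively P xs \<longleftrightarrow> (\<forall>(x, y)\<in>steps xs. P x y)"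
  by (induction xs rule: induct_list012) auto

lemma length_eq_card_steps:
  "distinct xs \<Longrightarrow> xs \<noteq> [] \<Longrightarrow> length xs = card (steps xs) + 1"
proof (induction xs rule: induct_list012)
  case (3 x y ys)
  have "(x, y) \<notin> steps (y # ys)" using steps_subset[of "y # ys"] "3.prems" by auto
  then show ?case using 3 by simp
qed auto

lemma asc_eq_card_steps:
  "distinct xs \<Longrightarrow> xs \<noteq> [] \<Longrightarrow> asc r xs = card (steps xs \<inter> (r - Id)) + 1"
proof (induction xs rule: induct_list012)
  case (3 x y ys)
  have "(x, y) \<notin> steps (y # ys)" using steps_subset[of "y # ys"] "3.prems" by auto
  then show ?case using 3 by (auto simp: Int_insert_left)
qed auto

lemma card_UN_steps_Int:
  "distinct (concat Ss) \<Longrightarrow>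
    card ((\<Union>xs\<in>set Ss. steps xs) \<inter> R) = (\<Sum>xs\<leftarrow>Ss. card (steps xs \<inter> R))"
proof (induction Ss)
  case (Cons xs Ss)
  have "steps xs \<inter> (\<Union>xs\<in>set Ss. steps xs) = {}"
    using Cons.prems steps_subset[of xs] steps_subset by fastforce
  then have "card ((steps xs \<union> (\<Union>xs\<in>set Ss. steps xs)) \<inter> R)
      = card (steps xs \<inter> R) + card ((\<Union>xs\<in>set Ss. steps xs) \<inter> R)"
    by (subst Int_Un_distrib2, subst card_Un_disjoint) auto
  then show ?case using Cons by simp
qed simp

lemma pairwise_disjoint_Cons:
  "pairwise_disjoint (xs # Ss) \<longleftrightarrow>
    (\<forall>ys\<in>set Ss. set xs \<inter> set ys = {}) \<and> pairwise_disjoint Ss"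
  unfolding pairwise_disjoint_def
  by (simp add: All_less_Suc2 all_set_conv_all_nth Int_commute[of _ "set xs"]) blast

lemma distinct_concat_iff_pairwise_disjoint:
  "distinct (concat Ss) \<longleftrightarrow> pairwise_disjoint Ss \<and> (\<forall>xs\<in>set Ss. distinct xs)"
  by (induction Ss) (auto simp: pairwise_disjoint_Cons, simp add: pairwise_disjoint_def)

lemma pairwise_disjoint_index:
  assumes "pairwise_disjoint Ss"
  obtains c where "\<forall>j<length Ss. \<forall>x\<in>set (Ss ! j). c x = j"
proof -
  define c where "c x = (THE j. j < length Ss \<and> x \<in> set (Ss ! j))" for x
  have "c x = j" if "j < length Ss" "x \<in> set (Ss ! j)" for x j
    unfolding c_def using assms that by (intro the_equality) (auto simp: pairwise_disjoint_def)
  then show thesis using that by blast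
qed

lemma A_families_iff:
  "Ss \<in> A_families S C k \<longleftrightarrow> length Ss = k \<and> distinct (concat Ss) \<and> set (concat Ss) \<subseteq> S \<and>
    (\<forall>xs\<in>set Ss. successively (\<lambda>x y. (x, y) \<in> C) xs)"
  unfolding A_families_def adjacentable_def distinct_concat_iff_pairwise_disjoint by auto

lemma desc_attained:
  assumes "distinct xs"
  obtains Y where "Y \<subseteq> set xs" and "card Y = desc r xs"
    and "sorted_wrt (\<lambda>x y. (x, y) \<notin> r - Id) (filter (\<lambda>x. x \<in> Y) xs)"
proof -
  have "desc r xs \<in> {length ys |ys. subseq ys xs \<and> sorted_wrt (\<lambda>x y. (x, y) \<notin> r - Id) ys}"
    unfolding desc_def by (rule Max_in[OF desc_set_wf])
  then obtain ys where ys: "subseq ys xs" "sorted_wrt (\<lambda>x y. (x, y) \<notin> r - Id) ys"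
      "length ys = desc r xs"
    by auto
  then obtain N where N: "ys = nths xs N" by (auto simp: subseq_conv_nths)
  then have "ys = filter (\<lambda>x. x \<in> set ys) xs" using assms by (simp add: filter_in_nths)
  moreover have "set ys \<subseteq> set xs" unfolding N by (rule set_nths_subset)
  moreover have "card (set ys) = desc r xs"
    using ys(3) assms unfolding N by (simp add: distinct_card distinct_nthsI)
  ultimately show thesis using ys(2) that[of "set ys"] by simp
qed

lemma desc_ge_length:
  "sorted_wrt (\<lambda>x y. (x, y) \<notin> r - Id) xs \<Longrightarrow> length xs \<le> desc r xs"
  unfolding desc_def by (rule Max_ge[OF desc_set_wf(1)]) auto

lemma sorted_wrt_key_lessD:
  fixes f :: "'a \<Rightarrow> 'b :: linorder"
  assumes "sorted_wrt P xs" and "sorted_wrt (\<lambda>x y. f x < f y) xs"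
    and "x \<in> set xs" and "y \<in> set xs" and "f x < f y"
  shows "P x y"
proof (use assms in \<open>induction xs\<close>)
  case (Cons z zs)
  then show ?case by (auto dest: less_asym)
qed simp

section \<open>Path covers\<close>

definition path_cover :: "'a set \<Rightarrow> ('a \<times> 'a) set \<Rightarrow> 'a list list \<Rightarrow> bool" where
  "path_cover V M Ss \<longleftrightarrow> distinct (concat Ss) \<and> set (concat Ss) = V \<and> [] \<notin> set Ss \<and>
     (\<Union>xs\<in>set Ss. steps xs) = M"

lemma hd_if_not_in_Range_steps: "x \<in> set xs \<Longrightarrow> x \<notin> Range (steps xs) \<Longrightarrow> x = hd xs"
  by (induction xs rule: induct_list012) auto

lemma path_cover_insert_isolated:
  "path_cover V M Ss \<Longrightarrow> z \<notin> V \<Longrightarrow> path_cover (insert z V) M ([z] # Ss)"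
  by (auto simp: path_cover_def)

lemma path_cover_insert_source:
  assumes cover: "path_cover V M Ss" and "x \<in> V" and "x \<notin> Range M" and "z \<notin> V"
  shows "\<exists>Ss. path_cover (insert z V) (insert (z, x) M) Ss"
proof -
  obtain xs where xs: "xs \<in> set Ss" "x \<in> set xs"
    using cover \<open>x \<in> V\<close> by (auto simp: path_cover_def)
  then have "x = hd xs"
    using cover \<open>x \<notin> Range M\<close> by (intro hd_if_not_in_Range_steps) (auto simp: path_cover_def)
  then obtain ys where ys: "xs = x # ys" using xs(2) by (cases xs) auto
  obtain Ss\<^sub>1 Ss\<^sub>2 where split: "Ss = Ss\<^sub>1 @ xs # Ss\<^sub>2" using xs(1) by (meson split_list)
  have "path_cover (insert z V) (insert (z, x) M) (Ss\<^sub>1 @ (z # xs) # Ss\<^sub>2)"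
    using cover \<open>z \<notin> V\<close> by (auto simp: path_cover_def split ys)
  then show ?thesis by blast
qed

lemma acyclic_source_exists:
  assumes "finite V" and "V \<noteq> {}" and "M \<subseteq> V \<times> V" and "acyclic M"
  obtains z where "z \<in> V" and "z \<notin> Range M"
proof -
  have "finite M" using assms(1,3) by (auto intro: finite_subset)
  then have "wf M" using assms(4) by (rule finite_acyclic_wf)
  then obtain z where "z \<in> V" "\<And>y. (y, z) \<in> M \<Longrightarrow> y \<notin> V"
    using assms(2) by (metis wfE_min ex_in_conv)
  then show thesis using assms(3) by (intro that[of z]) auto
qed

lemma acyclic_matching_path_cover:
  assumes "finite V" and "matching (V \<times> V) M" and "acyclic M"
  shows "\<exists>Ss. path_cover V M Ss"
  using assms
proof (induction V arbitrary: M rule: finite_psubset_induct)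
  case (psubset V)
  note M = psubset.prems(1)
  have M_sub: "M \<subseteq> V \<times> V" using M by (simp add: matching_def)
  show ?case
  proof (cases "V = {}")
    case True
    then have "path_cover V M []" using M_sub by (auto simp: path_cover_def)
    then show ?thesis by blast
  next
    case False
    then obtain z where z: "z \<in> V" "z \<notin> Range M"
      using acyclic_source_exists[OF psubset.hyps _ M_sub psubset.prems(2)] by blast
    define M' where "M' = M - {z} \<times> UNIV"
    have "matching ((V - {z}) \<times> (V - {z})) M'"
      by (rule matching_subset[OF M]) (use M_sub z(2) in \<open>auto simp: M'_def\<close>)
    moreover have "acyclic M'"
      using psubset.prems(2) by (rule acyclic_subset) (auto simp: M'_def)
    ultimately obtain Ss where cover: "path_cover (V - {z}) M' Ss"
      using psubset.IH[of "V - {z}"] z(1) by blast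
    show ?thesis
    proof (cases "z \<in> Domain M")
      case True
      then obtain x where x: "(z, x) \<in> M" by blast
      have "x \<in> V - {z}" using x M_sub z(2) by auto
      moreover have "x \<notin> Range M'"
        using matching_left_unique[OF M x] by (auto simp: M'_def)
      moreover have "M \<inter> {z} \<times> UNIV = {(z, x)}"
        using x matching_right_unique[OF M] by blast
      then have "insert (z, x) M' = M" by (auto simp: M'_def)
      ultimately show ?thesis
        using path_cover_insert_source[OF cover, of x z] insert_absorb[OF z(1)] by simp
    next
      case False
      then have "M' = M" by (auto simp: M'_def)
      then show ?thesis
        using path_cover_insert_isolated[OF cover, of z] insert_absorb[OF z(1)] by auto
    qed
  qed
qed

lemma path_cover_card:
  assumes "path_cover V M Ss"
  shows "length Ss + card M = card V"
    and "(\<Sum>xs\<leftarrow>Ss. asc r xs) = card (M \<inter> (r - Id)) + length Ss"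
proof -
  have Ss: "distinct (concat Ss)" "set (concat Ss) = V" "(\<Union>xs\<in>set Ss. steps xs) = M"
      "\<And>xs. xs \<in> set Ss \<Longrightarrow> distinct xs \<and> xs \<noteq> []"
    using assms by (auto simp: path_cover_def distinct_concat_iff)
  have "card V = (\<Sum>xs\<leftarrow>Ss. length xs)"
    using distinct_card[OF Ss(1)] Ss(2) by (simp add: length_concat)
  also have "\<dots> = (\<Sum>xs\<leftarrow>Ss. card (steps xs) + 1)"
    using Ss(4) by (intro arg_cong[of _ _ sum_list] map_cong length_eq_card_steps) auto
  also have "\<dots> = card M + length Ss"
    using card_UN_steps_Int[OF Ss(1), of UNIV] Ss(3) by (simp add: sum_list_Suc)
  finally show "length Ss + card M = card V" by simp
  have "(\<Sum>xs\<leftarrow>Ss. asc r xs) = (\<Sum>xs\<leftarrow>Ss. card (steps xs \<inter> (r - Id)) + 1)"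
    using Ss(4) by (intro arg_cong[of _ _ sum_list] map_cong asc_eq_card_steps) auto
  also have "\<dots> = card (M \<inter> (r - Id)) + length Ss"
    using card_UN_steps_Int[OF Ss(1), of "r - Id"] Ss(3) by (simp add: sum_list_Suc)
  finally show "(\<Sum>xs\<leftarrow>Ss. asc r xs) = card (M \<inter> (r - Id)) + length Ss" .
qed

section \<open>Chains and antichains of a refined order\<close>

lemma A'_ge:
  assumes "finite S" and "Ss \<in> A_families S C k"
  shows "(\<Sum>xs\<leftarrow>Ss. asc r xs) \<le> A' S r C k"
  unfolding A'_def using A_families_wf(1)[OF assms(1)] assms(2)
  by (intro Max_ge finite_imageI imageI)

lemma D'_ge:
  assumes "finite S" and "Ts \<in> D_families S h C l"
  shows "(\<Sum>xs\<leftarrow>Ts. desc r xs) \<le> D' S r h C l"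
  unfolding D'_def using D_families_wf(1)[OF assms(1)] assms(2)
  by (intro Max_ge finite_imageI imageI)

lemma A'_attained:
  assumes "finite S"
  obtains Ss where "Ss \<in> A_families S C k" "A' S r C k = (\<Sum>xs\<leftarrow>Ss. asc r xs)"
proof -
  have "A' S r C k \<in> (\<lambda>Ss. \<Sum>xs\<leftarrow>Ss. asc r xs) ` A_families S C k"
    unfolding A'_def by (rule Max_in) (auto simp: A_families_wf[OF assms])
  then show thesis using that by auto
qed

lemma D'_attained:
  assumes "finite S"
  obtains Ts where "Ts \<in> D_families S h C l" "D' S r h C l = (\<Sum>xs\<leftarrow>Ts. desc r xs)"
proof -
  have "D' S r h C l \<in> (\<lambda>Ss. \<Sum>xs\<leftarrow>Ss. desc r xs) ` D_families S h C l"
    unfolding D'_def by (rule Max_in) (auto simp: D_families_wf[OF assms])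
  then show thesis using that by auto
qed

lemma A'_0: "A' S r C 0 = 0"
  by (auto simp: A'_def A_families_def pairwise_disjoint_def)

lemma D'_0: "D' S r h C 0 = 0"
  by (auto simp: D'_def D_families_def pairwise_disjoint_def)

locale refined_order =
  fixes S :: "'a set" and r C :: "'a rel" and h :: "'a \<Rightarrow> nat"
  assumes fin: "finite S" and trans_r: "trans (r - Id)" and inj_h: "inj_on h S"
    and C_sub: "C \<subseteq> S \<times> S"
    and r_C: "\<And>x y. (x, y) \<in> r - Id \<Longrightarrow> h x < h y \<Longrightarrow> (x, y) \<in> C"
    and C_h: "\<And>x y. (x, y) \<in> C \<Longrightarrow> h x < h y"
    and C_trans: "\<And>x y z. (x, y) \<in> C \<Longrightarrow> (y, z) \<in> C \<Longrightarrow> (x, z) \<in> C"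
begin

abbreviation A :: "nat \<Rightarrow> nat" where "A \<equiv> A' S r C"

abbreviation D :: "nat \<Rightarrow> nat" where "D \<equiv> D' S r h C"

lemma acyclic_C: "acyclic C"
proof -
  have "trans C" using C_trans by (auto intro: transI)
  moreover have "irrefl C" using C_h by (auto simp: irrefl_def)
  ultimately show ?thesis by (simp add: acyclic_irrefl)
qed

lemma h_ordered_iff: "h_ordered S h xs \<longleftrightarrow> set xs \<subseteq> S \<and> sorted_wrt (\<lambda>x y. h x < h y) xs"
proof -
  have "successively (\<lambda>x y. h x < h y) xs \<longleftrightarrow> sorted_wrt (\<lambda>x y. h x < h y) xs"
    by (intro successively_conv_sorted_wrt) (auto intro: transpI)
  moreover have "distinct xs" if "sorted_wrt (\<lambda>x y. h x < h y) xs"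
    using that by (induction xs) auto
  ultimately show ?thesis by (auto simp: h_ordered_def)
qed

lemma ex_h_ordered_enumeration:
  assumes "X \<subseteq> S"
  shows "\<exists>xs. h_ordered S h xs \<and> set xs = X \<and> length xs = card X"
proof -
  interpret folding_insort_key "(\<le>)" "(<)" S h
    using inj_h by unfold_locales
  have "finite X" using assms fin by (rule finite_subset)
  with assms obtain xs where "sorted_wrt (<) (map h xs)" "set xs = X" "length xs = card X"
    by (rule finite_set_strict_sorted)
  then show ?thesis
    using assms by (auto simp: h_ordered_iff sorted_wrt_map)
qed

text \<open>A family counted by \<open>D'\<close>, recorded as the label \<open>c x\<close> of the member containing \<open>x\<close>.\<close>

definition antichain_labelling :: "nat \<Rightarrow> ('a \<Rightarrow> nat) \<Rightarrow> 'a set \<Rightarrow> bool" where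
  "antichain_labelling l c X \<longleftrightarrow> X \<subseteq> S \<and> c ` X \<subseteq> {..<l} \<and>
     (\<forall>x\<in>X. \<forall>y\<in>X. (x, y) \<in> C \<and> c x = c y \<longrightarrow> (x, y) \<notin> r) \<and>
     (\<forall>x\<in>X. \<forall>y\<in>X. \<forall>x'\<in>X. \<forall>y'\<in>X.
        (x, y) \<in> C \<and> (y', x') \<in> C \<and> c x = c x' \<and> c y = c y' \<longrightarrow> c x = c y)"

lemma antichain_labelling_antichain:
  "antichain_labelling l c X \<Longrightarrow> x \<in> X \<Longrightarrow> y \<in> X \<Longrightarrow> (x, y) \<in> C \<Longrightarrow> c x = c y \<Longrightarrow>
    (x, y) \<notin> r"
  unfolding antichain_labelling_def by blast

lemma antichain_labelling_not_overlapping: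
  assumes "antichain_labelling l c X" and "{x, y, x', y'} \<subseteq> X"
    and "(x, y) \<in> C" and "(y', x') \<in> C" and "c x = c x'" and "c y = c y'"
  shows "c x = c y"
proof -
  have "\<forall>x\<in>X. \<forall>y\<in>X. \<forall>x'\<in>X. \<forall>y'\<in>X.
      (x, y) \<in> C \<and> (y', x') \<in> C \<and> c x = c x' \<and> c y = c y' \<longrightarrow> c x = c y"
    using assms(1) unfolding antichain_labelling_def by (elim conjE)
  from this[rule_format, of x y x' y'] show ?thesis using assms(2-) by blast
qed

lemma ex_antichain_card_desc:
  assumes "h_ordered S h xs"
  shows "\<exists>Y\<subseteq>set xs. card Y = desc r xs \<and> (\<forall>x\<in>Y. \<forall>y\<in>Y. (x, y) \<in> C \<longrightarrow> (x, y) \<notin> r)"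
proof -
  have sorted: "sorted_wrt (\<lambda>x y. h x < h y) xs"
    using assms by (simp add: h_ordered_iff)
  have "distinct xs" using assms by (simp add: h_ordered_def)
  then obtain Y where Y: "Y \<subseteq> set xs" "card Y = desc r xs"
      "sorted_wrt (\<lambda>x y. (x, y) \<notin> r - Id) (filter (\<lambda>x. x \<in> Y) xs)"
    using desc_attained by blast
  have "(x, y) \<notin> r" if "x \<in> Y" "y \<in> Y" "(x, y) \<in> C" for x y
  proof -
    have "x \<in> set (filter (\<lambda>x. x \<in> Y) xs)" "y \<in> set (filter (\<lambda>x. x \<in> Y) xs)"
      using that Y(1) by auto
    then have "(x, y) \<notin> r - Id"
      using C_h[OF that(3)] by (rule sorted_wrt_key_lessD[OF Y(3) sorted_wrt_filter[OF sorted]])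
    then show ?thesis using C_h[OF that(3)] by auto
  qed
  then show ?thesis using Y(1,2) by blast
qed

lemma antichain_labelling_UN:
  assumes Ts: "Ts \<in> D_families S h C l"
    and label: "\<forall>j<l. \<forall>x\<in>set (Ts ! j). c x = j"
    and Y: "\<forall>j<l. Y j \<subseteq> set (Ts ! j) \<and> (\<forall>x\<in>Y j. \<forall>y\<in>Y j. (x, y) \<in> C \<longrightarrow> (x, y) \<notin> r)"
  shows "antichain_labelling l c (\<Union>j<l. Y j)"
  unfolding antichain_labelling_def
proof (intro conjI ballI impI)
  let ?X = "\<Union>j<l. Y j"
  have X: "c x < l" "x \<in> Y (c x)" "x \<in> set (Ts ! c x)" if "x \<in> ?X" for x
    using that label Y by fastforce+
  show "?X \<subseteq> S"
    using Y Ts by (fastforce simp: D_families_def h_ordered_def)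
  show "c ` ?X \<subseteq> {..<l}" using X(1) by blast
  show "(x, y) \<notin> r" if "x \<in> ?X" "y \<in> ?X" "(x, y) \<in> C \<and> c x = c y" for x y
    using X[OF that(1)] X[OF that(2)] Y that(3) by metis
  show "c x = c y" if "x \<in> ?X" "y \<in> ?X" "x' \<in> ?X" "y' \<in> ?X"
    "(x, y) \<in> C \<and> (y', x') \<in> C \<and> c x = c x' \<and> c y = c y'" for x y x' y'
  proof (rule ccontr)
    assume "c x \<noteq> c y"
    then have "\<not> semi_overlapping C (Ts ! c x) (Ts ! c y)"
      using Ts X(1)[OF that(1)] X(1)[OF that(2)] by (auto simp: D_families_def)
    then show False using that(1-4)[THEN X(3)] that(5) unfolding semi_overlapping_def by metis
  qed
qed

lemma antichain_labelling_of_D: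
  obtains c X where "antichain_labelling l c X" and "card X = D l"
proof -
  obtain Ts where Ts: "Ts \<in> D_families S h C l" and D: "D l = (\<Sum>xs\<leftarrow>Ts. desc r xs)"
    by (rule D'_attained[OF fin])
  have len: "length Ts = l" using Ts by (simp add: D_families_def)
  have ordered: "h_ordered S h (Ts ! j)" if "j < l" for j
    using Ts that by (auto simp: D_families_def)
  obtain c where c: "\<forall>j<l. \<forall>x\<in>set (Ts ! j). c x = j"
    using pairwise_disjoint_index[of Ts] Ts by (auto simp: D_families_def)
  obtain Y where Y: "\<forall>j<l. Y j \<subseteq> set (Ts ! j) \<and> card (Y j) = desc r (Ts ! j) \<and>
      (\<forall>x\<in>Y j. \<forall>y\<in>Y j. (x, y) \<in> C \<longrightarrow> (x, y) \<notin> r)"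
    using ex_antichain_card_desc[OF ordered] by metis
  have "c x = j" if "j < l" "x \<in> Y j" for j x
    using Y c that by blast
  then have disjoint: "Y i \<inter> Y j = {}" if "i < l" "j < l" "i \<noteq> j" for i j
    using that by (metis disjoint_iff)
  have "finite (Y j)" if "j < l" for j
    using Y that by (auto intro: finite_subset[of _ "set (Ts ! j)"])
  then have "card (\<Union>j<l. Y j) = (\<Sum>j<l. card (Y j))"
    using disjoint by (intro card_UN_disjoint) auto
  also have "\<dots> = D l"
    using Y len D by (simp add: sum_list_sum_nth atLeast0LessThan)
  finally show thesis
    using antichain_labelling_UN[OF Ts c, of Y] Y that by blast
qed

lemma card_antichain_labelling_le_D:
  assumes "antichain_labelling l c X"
  shows "card X \<le> D l"
proof -
  have X: "X \<subseteq> S" "c ` X \<subseteq> {..<l}"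
    using assms by (auto simp: antichain_labelling_def)
  define Y where "Y j = {x \<in> X. c x = j}" for j
  have Y_sub: "Y j \<subseteq> S" for j using X(1) by (auto simp: Y_def)
  obtain t where t: "\<And>j. h_ordered S h (t j)" "\<And>j. set (t j) = Y j"
      "\<And>j. length (t j) = card (Y j)"
    using ex_h_ordered_enumeration[OF Y_sub] by metis
  have "\<not> semi_overlapping C (t i) (t j)" if "i \<noteq> j" for i j
    using antichain_labelling_not_overlapping[OF assms] that
    by (fastforce simp: semi_overlapping_def t(2) Y_def)
  then have "map t [0..<l] \<in> D_families S h C l"
    using t(1) by (auto simp: D_families_def pairwise_disjoint_def t(2) Y_def)
  then have "(\<Sum>xs\<leftarrow>map t [0..<l]. desc r xs) \<le> D l"
    by (rule D'_ge[OF fin])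
  moreover have "card (Y j) \<le> desc r (t j)" for j
  proof -
    have "(x, y) \<notin> r - Id" if "x \<in> Y j" "y \<in> Y j" "h x < h y" for x y
      using antichain_labelling_antichain[OF assms, of x y] that r_C[of x y] by (auto simp: Y_def)
    then have "sorted_wrt (\<lambda>x y. (x, y) \<notin> r - Id) (t j)"
      using t(1)[of j] by (auto simp: h_ordered_iff t(2) intro: sorted_wrt_mono_rel[rotated])
    then show ?thesis using desc_ge_length t(3) by metis
  qed
  then have "(\<Sum>j<l. card (Y j)) \<le> (\<Sum>xs\<leftarrow>map t [0..<l]. desc r xs)"
    by (simp add: sum_list_sum_nth atLeast0LessThan sum_mono)
  moreover have "card X = (\<Sum>j<l. card (Y j))"
    using sum.group[of X "{..<l}" c "\<lambda>_. 1 :: nat"] X fin by (simp add: Y_def finite_subset)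
  ultimately show ?thesis by simp
qed

lemma asc_le_antichain_labelling:
  assumes c: "antichain_labelling l c X" and "successively (\<lambda>x y. (x, y) \<in> C) xs"
  shows "asc r xs \<le> length (filter (\<lambda>x. x \<notin> X) xs) + l"
proof -
  have "transp (\<lambda>x y. (x, y) \<in> C)" using C_trans by (auto intro: transpI)
  then have "sorted_wrt (\<lambda>x y. (x, y) \<in> C) xs"
    using assms(2) by (simp add: successively_conv_sorted_wrt)
  then have "asc r xs \<le> length (filter (\<lambda>x. x \<notin> X) xs) + card (c ` (set xs \<inter> X))"
  proof (rule asc_le_card_labels[OF trans_r])
    show "(x, y) \<notin> r" if "{x, y} \<subseteq> X" "(x, y) \<in> C" "c x = c y" for x y
      using antichain_labelling_antichain[OF c] that by simp
    show "c x = c y" if "{x, y, z} \<subseteq> X" "(x, y) \<in> C" "(y, z) \<in> C" "c x = c z" for x y z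
      using antichain_labelling_not_overlapping[OF c, of x y z y] that by simp
  qed
  also have "card (c ` (set xs \<inter> X)) \<le> card {..<l}"
    using c by (intro card_mono) (auto simp: antichain_labelling_def)
  finally show ?thesis by simp
qed

theorem weak_duality: "A k + D l \<le> card S + k * l"
proof -
  obtain Ss where "Ss \<in> A_families S C k" and A: "A k = (\<Sum>xs\<leftarrow>Ss. asc r xs)"
    by (rule A'_attained[OF fin])
  then have Ss: "length Ss = k" "distinct (concat Ss)" "set (concat Ss) \<subseteq> S"
      "\<And>xs. xs \<in> set Ss \<Longrightarrow> successively (\<lambda>x y. (x, y) \<in> C) xs"
    by (auto simp: A_families_iff)
  obtain c X where c: "antichain_labelling l c X" and X: "card X = D l"
    by (rule antichain_labelling_of_D)
  have "X \<subseteq> S" using c by (simp add: antichain_labelling_def)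
  let ?rest = "filter (\<lambda>x. x \<notin> X) (concat Ss)"
  have "A k \<le> (\<Sum>xs\<leftarrow>Ss. length (filter (\<lambda>x. x \<notin> X) xs) + l)"
    unfolding A using asc_le_antichain_labelling[OF c] Ss(4) by (intro sum_list_mono) auto
  also have "\<dots> = length ?rest + k * l"
    using Ss(1) by (simp add: sum_list_addf sum_list_triv filter_concat length_concat comp_def)
  also have "length ?rest = card (set ?rest)"
    using Ss(2) by (intro distinct_card[symmetric] distinct_filter)
  also have "\<dots> \<le> card (S - X)"
    using Ss(3) fin by (intro card_mono) auto
  also have "card (S - X) = card S - D l"
    using \<open>X \<subseteq> S\<close> fin X by (simp add: card_Diff_subset finite_subset)
  finally show ?thesis
    using card_mono[OF fin \<open>X \<subseteq> S\<close>] X by simp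
qed

lemma A_ge_chains:
  assumes "V \<subseteq> S" and "matching (V \<times> V) M" and "M \<subseteq> C" and "card V \<le> card M + k"
  shows "card (M \<inter> (r - Id)) + card V \<le> A k + card M"
proof -
  have "finite V" using assms(1) fin by (rule finite_subset)
  then obtain Ss where cover: "path_cover V M Ss"
    using acyclic_matching_path_cover[OF _ assms(2) acyclic_subset[OF acyclic_C assms(3)]] by blast
  let ?Ss = "Ss @ replicate (k - length Ss) []"
  have "?Ss \<in> A_families S C k"
    using cover assms path_cover_card(1)[OF cover]
    by (auto simp: A_families_iff path_cover_def successively_iff_steps)
  then have "(\<Sum>xs\<leftarrow>?Ss. asc r xs) \<le> A k"
    by (rule A'_ge[OF fin])
  then show ?thesis
    using path_cover_card(1)[OF cover] path_cover_card(2)[OF cover, of r]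
    by (simp add: sum_list_replicate)
qed

text \<open>A loop in a matching of \<open>links\<close> marks an element that no chain uses.\<close>

abbreviation links :: "'a rel" where "links \<equiv> C \<union> Id_on S"

abbreviation gain :: "'a \<Rightarrow> 'a \<Rightarrow> int" where "gain x y \<equiv> of_bool ((x, y) \<in> r - Id) - 1"

lemma links_sub: "links \<subseteq> S \<times> S"
  using C_sub by auto

lemma sum_gain:
  assumes "matching links M"
  shows "(\<Sum>(x, y)\<in>M. gain x y + a) = int (card (M \<inter> (r - Id))) + (a - 1) * int (card M)"
proof -
  have "finite M"
    using assms links_sub fin fin by (rule finite_matching)
  have "(\<Sum>(x, y)\<in>M. gain x y + a) = (\<Sum>e\<in>M. of_bool (e \<in> r - Id) + (a - 1))"
    by (intro sum.cong) auto
  then show ?thesis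
    using \<open>finite M\<close> by (simp add: sum.distrib Int_def del: Diff_iff)
qed

lemma A_ge_matching:
  assumes M: "matching links M" and k: "card S \<le> card M + k"
  shows "card (M \<inter> (r - Id)) + card S \<le> A k + card M"
proof -
  define V where "V = {x \<in> S. (x, x) \<notin> M}"
  have M_sub: "M \<subseteq> links" using M by (simp add: matching_def)
  have "finite M" using M links_sub fin fin by (rule finite_matching)
  have "x \<in> V \<and> y \<in> V" if "(x, y) \<in> M - Id" for x y
    using matching_right_unique[OF M, of x y x] matching_left_unique[OF M, of x y y]
      that M_sub C_sub
    by (auto simp: V_def)
  then have V: "matching (V \<times> V) (M - Id)"
    by (intro matching_subset[OF M]) auto
  have "M \<inter> Id = (\<lambda>x. (x, x)) ` (S - V)"
    using M_sub C_h by (auto simp: V_def)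
  then have "card (M \<inter> Id) = card (S - V)"
    by (simp add: card_image inj_on_def)
  moreover have "card (S - V) + card V = card S"
    using fin by (subst card_Diff_subset) (auto simp: V_def card_mono)
  moreover have "card (M \<inter> Id) + card (M - Id) = card M"
    using \<open>finite M\<close> card_mono[of M "M \<inter> Id"] by (simp add: card_Diff_subset_Int)
  moreover have "M - Id \<subseteq> C" "V \<subseteq> S" using M_sub by (auto simp: V_def)
  moreover have "(M - Id) \<inter> (r - Id) = M \<inter> (r - Id)" by blast
  ultimately show ?thesis
    using A_ge_chains[of V "M - Id" k] V k by simp
qed

lemma level_set_antichain_labelling:
  fixes u v :: "'a \<Rightarrow> int"
  assumes nonneg: "\<forall>x\<in>S. 0 \<le> u x" "\<forall>y\<in>S. 0 \<le> v y"
    and dual: "feasible_dual links (\<lambda>x y. gain x y + int l) u v"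
  shows "antichain_labelling l (\<lambda>x. nat (u x)) {x \<in> S. u x + v x = int l - 1}"
  unfolding antichain_labelling_def
proof (intro conjI ballI impI)
  let ?X = "{x \<in> S. u x + v x = int l - 1}"
  have antitone: "u y + of_bool ((x, y) \<in> r) \<le> u x" if "(x, y) \<in> C" "y \<in> ?X" for x y
  proof -
    have "gain x y + int l \<le> u x + v y"
      by (rule feasible_dualD[OF dual]) (use that(1) in simp)
    moreover have "x \<noteq> y" using C_h[OF that(1)] by auto
    ultimately show ?thesis using that(2) by simp
  qed
  show "?X \<subseteq> S" by auto
  show "(\<lambda>x. nat (u x)) ` ?X \<subseteq> {..<l}" using nonneg by force
  show "(x, y) \<notin> r" if "x \<in> ?X" "y \<in> ?X" "(x, y) \<in> C \<and> nat (u x) = nat (u y)" for x y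
    using antitone[of x y] nonneg that by auto
  show "nat (u x) = nat (u y)" if "x \<in> ?X" "y \<in> ?X" "x' \<in> ?X" "y' \<in> ?X"
    "(x, y) \<in> C \<and> (y', x') \<in> C \<and> nat (u x) = nat (u x') \<and> nat (u y) = nat (u y')"
    for x y x' y'
    using antitone[of x y] antitone[of y' x'] that by (auto simp: of_bool_def split: if_splits)
qed

lemma D_ge_dual:
  fixes u v :: "'a \<Rightarrow> int"
  assumes nonneg: "\<forall>x\<in>S. 0 \<le> u x" "\<forall>y\<in>S. 0 \<le> v y"
    and dual: "feasible_dual links (\<lambda>x y. gain x y + int l) u v"
  shows "int l * int (card S) - (sum u S + sum v S) \<le> int (D l)"
proof -
  have loop: "int l - 1 \<le> u x + v x" if "x \<in> S" for x
    using feasible_dualD[OF dual, of x x] that by auto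
  have "int l * int (card S) - (sum u S + sum v S) = (\<Sum>x\<in>S. int l - (u x + v x))"
    by (simp add: sum_subtractf sum.distrib)
  also have "\<dots> \<le> (\<Sum>x\<in>S. of_bool (u x + v x = int l - 1))"
    using loop by (intro sum_mono) fastforce
  also have "\<dots> = int (card {x \<in> S. u x + v x = int l - 1})"
    using fin by (simp add: Int_def)
  also have "\<dots> \<le> int (D l)"
    using card_antichain_labelling_le_D[OF level_set_antichain_labelling[OF assms]] by simp
  finally show ?thesis .
qed

lemma strong_duality_certificate:
  fixes u v :: "'a \<Rightarrow> int"
  assumes M: "matching links M" "card S \<le> card M + k"
    and nonneg: "\<forall>x\<in>S. 0 \<le> u x" "\<forall>y\<in>S. 0 \<le> v y"
    and dual: "feasible_dual links (\<lambda>x y. gain x y + int l) u v"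
    and sum_le: "sum u S + sum v S
      \<le> int (card (M \<inter> (r - Id))) - int (card M) + int l * (int (card S) - int k)"
  shows "card S + k * l \<le> A k + D l"
proof -
  have "int (card (M \<inter> (r - Id))) + int (card S) \<le> int (A k) + int (card M)"
    using A_ge_matching[OF M] by linarith
  then have "int (card S) + int k * int l \<le> int (A k) + int (D l)"
    using D_ge_dual[OF nonneg dual] sum_le by (simp add: algebra_simps)
  then show ?thesis by (simp flip: of_nat_mult of_nat_add)
qed

lemma strong_duality_D: "\<exists>k. card S + k * l \<le> A k + D l"
proof -
  let ?N = "{} :: 'a rel"
  have empty: "matching links ?N" by (simp add: matching_def)
  obtain M slope u v where M: "matching links M" and "card ?N \<le> card M" and slope: "0 \<le> slope"
      and nonneg: "\<forall>x\<in>S. 0 \<le> u x" "\<forall>y\<in>S. 0 \<le> v y"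
      and dual: "feasible_dual links (\<lambda>x y. gain x y + int l + slope) u v"
      and sum_le: "sum u S + sum v S
        \<le> (\<Sum>(x, y)\<in>M. gain x y + int l) + slope * int (card ?N)"
    by (rule matching_duality[OF fin fin links_sub empty, of "\<lambda>x y. gain x y + int l"])
  have "card M \<le> card S"
    using card_uncovered_left[OF M links_sub fin] by linarith
  then have "sum u S + sum v S
      \<le> int (card (M \<inter> (r - Id))) - int (card M) + int l * (int (card S) - int (card S - card M))"
    using sum_le sum_gain[OF M, of "int l"] by (simp add: algebra_simps of_nat_diff)
  moreover have "feasible_dual links (\<lambda>x y. gain x y + int l) u v"
    by (rule feasible_dual_mono[OF dual]) (use slope in simp)
  ultimately have "card S + (card S - card M) * l \<le> A (card S - card M) + D l"
    using M nonneg by (intro strong_duality_certificate) auto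
  then show ?thesis by blast
qed

lemma strong_duality_A: "\<exists>l. card S + k * l \<le> A k + D l"
proof (cases "k \<le> card S")
  case False
  have "card S \<le> A k"
    using A_ge_matching[of "{}" k] False by (simp add: matching_def)
  then show ?thesis by (intro exI[of _ 0]) simp
next
  case True
  obtain T where T: "T \<subseteq> S" "card T = card S - k"
    by (rule obtain_subset_with_card_n[of "card S - k" S]) auto
  have loops: "matching links (Id_on T)"
    using T(1) by (auto simp: matching_def single_valued_def)
  have "Id_on T = (\<lambda>x. (x, x)) ` T" by auto
  then have card_loops: "card (Id_on T) = card S - k"
    using T(2) by (simp add: card_image inj_on_def)
  obtain M slope u v where M: "matching links M" "card (Id_on T) \<le> card M" and slope: "0 \<le> slope"
      and nonneg: "\<forall>x\<in>S. 0 \<le> u x" "\<forall>y\<in>S. 0 \<le> v y"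
      and dual: "feasible_dual links (\<lambda>x y. gain x y + slope) u v"
      and sum_le: "sum u S + sum v S \<le> (\<Sum>(x, y)\<in>M. gain x y) + slope * int (card (Id_on T))"
    by (rule matching_duality[OF fin fin links_sub loops])
  have "sum u S + sum v S
      \<le> int (card (M \<inter> (r - Id))) - int (card M) + int (nat slope) * (int (card S) - int k)"
    using sum_le sum_gain[OF M(1), of 0] slope True by (simp add: card_loops of_nat_diff)
  moreover have "feasible_dual links (\<lambda>x y. gain x y + int (nat slope)) u v"
    using dual slope by simp
  moreover have "card S \<le> card M + k" using M(2) card_loops by simp
  ultimately have "card S + k * nat slope \<le> A k + D (nat slope)"
    using M nonneg by (intro strong_duality_certificate) auto
  then show ?thesis by blast
qed

end

theorem theorem2p1:
  fixes S :: "'a set" and r C :: "'a rel" and h :: "'a \<Rightarrow> nat" and n :: nat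
    and lam mu :: "nat \<Rightarrow> int"
  assumes "finite S" and "card S = n" and "partial_order_on S r"
    and "bij_betw h S {1..n}"
    and "C \<subseteq> S \<times> S" and "\<And>x y. (x, y) \<in> C \<Longrightarrow> x \<noteq> y"
    and "\<And>x y. (x, y) \<in> r - Id \<Longrightarrow> h x < h y \<Longrightarrow> (x, y) \<in> C"
    and "\<And>x y. (x, y) \<in> C \<Longrightarrow> h x < h y"
    and "\<And>x y z. (x, y) \<in> C \<Longrightarrow> (y, z) \<in> C \<Longrightarrow> (x, z) \<in> C"
    and "lam 1 = int (A' S r C 1)"
    and "\<And>k. k \<ge> 2 \<Longrightarrow> lam k = int (A' S r C k) - int (A' S r C (k - 1))"
    and "mu 1 = int (D' S r h C 1)"
    and "\<And>k. k \<ge> 2 \<Longrightarrow> mu k = int (D' S r h C k) - int (D' S r h C (k - 1))"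
  shows "is_partition n lam \<and> is_partition n mu \<and> conjugate_of mu lam \<and> conjugate_of lam mu"
proof -
  have "trans (r - Id)"
    using \<open>partial_order_on S r\<close>
    by (simp add: partial_order_on_def preorder_on_def trans_diff_Id)
  moreover have "inj_on h S"
    using \<open>bij_betw h S {1..n}\<close> by (rule bij_betw_imp_inj_on)
  ultimately interpret refined_order S r C h
    using assms(1,5,7-9) by unfold_locales
  let ?A = "\<lambda>k. int (A k)" and ?D = "\<lambda>l. int (D l)"
  have weak: "?A k + ?D l \<le> int n + int k * int l" for k l
    using weak_duality[of k l] \<open>card S = n\<close> by (simp flip: of_nat_mult of_nat_add)
  have strong: "\<exists>l. int n + int k * int l \<le> ?A k + ?D l" "\<exists>k. int n + int k * int l \<le> ?A k + ?D l"
    for k l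
    using strong_duality_A[of k] strong_duality_D[of l] \<open>card S = n\<close>
    by (simp_all flip: of_nat_mult of_nat_add)
  interpret tight_pairs ?A ?D n
    by unfold_locales (use weak strong in \<open>simp_all add: A'_0 D'_0 order_eq_iff\<close>)
  have lam: "lam k = increment ?A k" and mu: "mu k = increment ?D k" if "1 \<le> k" for k
    using assms(10-13) A0 D0 that by (cases "k = 1"; simp add: increment_def)+
  show ?thesis
    using is_partition_increment[OF lam] swap.is_partition_increment[OF mu]
      conjugate_of_increment[OF lam mu] swap.conjugate_of_increment[OF mu lam]
    by blast
qed

end
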